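(* Let $r>0$ be an integer and let $(s_n(x))_{n\ge 0}$ be the sequence of polynomials extending the path counts $s_n(m)=s_n(m;r)$ described in the context. Then for every integer $n\ge 0$, as an identity of rational functions in $x$, $$s_{n}(x)=\frac{x-n+1}{x+1}\binom{x+1}{n}_{r}=\frac{x-n+1}{x+1}\sum_{i=0}^{\lfloor n/r\rfloor}(-1)^{i}\binom{x+1}{i}\binom{x+n-ri}{n-ri}.$$
   Context: Path counts. For $(n,m)\in\mathbb{Z}^2$, $s_n(m)=s_n(m;r)$ is the number of lattice paths from $(0,0)$ to $(n,m)$ with unit steps $\uparrow=(0,1)$ and $\rightarrow=(1,0)$ that stay weakly above the diagonal $y=x$ and contain no $r$ consecutive $\rightarrow$ steps. In particular $s_0(m)=1$ for all $m\ge 0$, $s_n(m)=0$ if $n<0$, and $s_n(m)=0$ if $m+1=n>0$. Extension. These path counts (used for $m\ge n\ge 0$, together with $s_n(n-1)=0$ for $n>0$) are extended to all integers $m$ as follows: $s_n(m)=0$ for all $m$ if $n<0$; $s_0(m)=1$ for all $m\in\mathbb{Z}$; and for $n>0$ the values $s_n(m)$ with $m<n-1$ are defined by requiring the recurrence $s_{n}(m)=s_{n-1}(m)+s_{n}(m-1)-s_{n-r}(m-1)$ to hold for all $m\in\mathbb{Z}$. For each $n\ge 0$ the function $m\mapsto s_n(m)$ on $\mathbb{Z}$ is then given by a polynomial, and $s_n(x)$ denotes this polynomial in a real variable $x$. Euler coefficient. $\binom{x}{n}_r=[t^n](1+t+\cdots+t^{r-1})^x$, the coefficient of $t^n$ in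 the formal power series; it is a polynomial in $x$. Ordinary binomial coefficients $\binom{x}{k}$ are the usual polynomials in $x$. *)

theory Defs
  imports
    "HOL-Library.Sublist"
    "HOL-Computational_Algebra.Computational_Algebra"
begin

datatype step = North | East

definition endpoint :: "step list \<Rightarrow> int \<times> int" where
  "endpoint w = (int (count_list w East), int (count_list w North))"

definition weakly_above_diagonal :: "step list \<Rightarrow> bool" where
  "weakly_above_diagonal w \<longleftrightarrow>
     (\<forall>u. prefix u w \<longrightarrow> fst (endpoint u) \<le> snd (endpoint u))"

definition lattice_paths :: "nat \<Rightarrow> int \<Rightarrow> int \<Rightarrow> step list set" where
  "lattice_paths r n m =
     {w. endpoint w = (n, m) \<and> weakly_above_diagonal w \<and> \<not> sublist (replicate r East) w}"

definition path_count :: "nat \<Rightarrow> int \<Rightarrow> int \<Rightarrow> int" where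
  "path_count r n m = int (card (lattice_paths r n m))"

text \<open>
  The path counts, extended below the diagonal. The last branch is the recurrence
  \<open>s n m' = s (n - 1) m' + s n (m' - 1) - s (n - r) (m' - 1)\<close> at \<open>m' = m + 1\<close>, solved for
  \<open>s n (m' - 1)\<close>. The case \<open>r = 0\<close> is excluded only to make the recursion terminate.
\<close>

function extended_count :: "nat \<Rightarrow> int \<Rightarrow> int \<Rightarrow> int" where
  "extended_count r n m =
    (if r = 0 \<or> n < 0 then 0
     else if n = 0 then 1
     else if m \<ge> n then path_count r n m
     else if m = n - 1 then 0
     else extended_count r n (m + 1) - extended_count r (n - 1) (m + 1)
            + extended_count r (n - int r) m)"
  by pat_completeness auto
termination
  by (relation "measures [\<lambda>(r, n, m). nat n, \<lambda>(r, n, m). nat (n - m)]") auto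

text \<open>The recursive equation loops as a rewrite rule.\<close>

declare extended_count.simps [simp del]

definition count_poly :: "nat \<Rightarrow> nat \<Rightarrow> real poly" where
  "count_poly r n =
     (THE p. \<forall>m::int. poly p (of_int m) = of_int (extended_count r (int n) m))"

text \<open>
  The coefficient of \<open>t\<^sup>n\<close> in \<open>F\<^sup>x\<close> for \<open>F = 1 + t + \<dots> + t\<^bsup>r-1\<^esup>\<close>. As \<open>F\<close> has constant
  coefficient 1 for \<open>r > 0\<close>, the power is the binomial series \<open>(1 + t)\<^sup>x\<close> with \<open>F - 1\<close>
  substituted for \<open>t\<close>.
\<close>

definition euler_coeff :: "nat \<Rightarrow> real \<Rightarrow> nat \<Rightarrow> real" where
  "euler_coeff r x n =
     fps_nth (fps_compose (fps_binomial x) ((\<Sum>i<r. fps_X ^ i) - 1)) n"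

end

theory Submission
  imports Defs
begin

text \<open>
  Write \<open>F = 1 + t + \<dots> + t\<^bsup>r-1\<^esup>\<close>. The polynomials \<open>s\<^sub>n(x)\<close> are the coefficients of
  \<open>G\<^sub>x(t) = F\<^sup>x (F - t F')\<close>. For integer \<open>x = m\<close> this holds because both sides satisfy the
  same recurrence and boundary conditions, which determine them by induction on \<open>n\<close>, and then on
  \<open>m\<close> upwards and downwards from \<open>n - 1\<close>:

  \<^item> The recurrence \<open>s\<^sub>n(x) = s\<^sub>n\<^sub>-\<^sub>1(x) + s\<^sub>n(x - 1) - s\<^sub>n\<^sub>-\<^sub>r(x - 1)\<close> says that
    \<open>(1 - t) G\<^sub>x = (1 - t\<^sup>r) G\<^sub>x\<^sub>-\<^sub>1\<close>, which follows from \<open>(1 - t) F = 1 - t\<^sup>r\<close>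
    (\<open>count_gf_recurrence\<close>). For the path counts it comes from splitting off the last step:
    a path that acquires a forbidden run when an East step is appended ends in a North step followed
    by \<open>r - 1\<close> East steps (\<open>path_count_recurrence\<close>).

  \<^item> Since \<open>(x + 1) G\<^sub>x = (x + 1) F\<^bsup>x+1\<^esup> - t (F\<^bsup>x+1\<^esup>)'\<close>, the coefficient of \<open>t\<^sup>n\<close> in
    \<open>(x + 1) G\<^sub>x\<close> is \<open>x + 1 - n\<close> times the Euler coefficient
    (\<open>count_gf_nth_eq_euler_coeff\<close>). So it vanishes at \<open>x = n - 1\<close> for \<open>n > 0\<close>, as required
    of \<open>s\<^sub>n\<close>, and the first formula of the theorem drops out once \<open>G\<^sub>x\<close> is known to generate
    the \<open>s\<^sub>n(x)\<close>.

  The coefficients of \<open>G\<^sub>x\<close> are polynomials in \<open>x\<close>, so agreement at the integers suffices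
  (\<open>poly_count_poly\<close>). The explicit sum is the Cauchy product in
  \<open>F\<^sup>y = (1 - t\<^sup>r)\<^sup>y (1 - t)\<^bsup>-y\<^esup>\<close> (\<open>euler_coeff_eq_sum\<close>); it needs the multiplicativity
  \<open>(H K)\<^sup>a = H\<^sup>a K\<^sup>a\<close> of powers with arbitrary exponents (\<open>fps_rpow_mult\<close>).
\<close>

section \<open>Powers of formal power series with exponents in a field\<close>

text \<open>
  The power \<open>H\<^sup>a\<close> of a series \<open>H\<close> with constant coefficient 1, obtained by substituting
  \<open>H - 1\<close> into the binomial series \<open>(1 + t)\<^sup>a\<close>. For other \<open>H\<close> the value is meaningless,
  although its constant coefficient is still 1.
\<close>

definition fps_rpow :: "'a::field_char_0 fps \<Rightarrow> 'a \<Rightarrow> 'a fps" where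
  "fps_rpow H a = fps_binomial a oo (H - 1)"

lemma fps_rpow_nth_0 [simp]: "fps_rpow H a $ 0 = 1"
  by (simp add: fps_rpow_def)

lemma fps_rpow_0 [simp]: "fps_rpow H 0 = 1"
  by (simp add: fps_rpow_def)

lemma fps_rpow_1: "H $ 0 = 1 \<Longrightarrow> fps_rpow H 1 = H"
  by (simp add: fps_rpow_def fps_binomial_1 fps_compose_add_distrib)

lemma fps_rpow_add: "H $ 0 = 1 \<Longrightarrow> fps_rpow H (a + b) = fps_rpow H a * fps_rpow H b"
  by (simp add: fps_rpow_def fps_binomial_add_mult fps_compose_mult_distrib)

lemma fps_deriv_binomial: "fps_deriv (fps_binomial a) = fps_const a * fps_binomial (a - 1)"
proof -
  have "fps_deriv (fps_binomial a) = fps_const a * (fps_binomial a * fps_binomial (- 1))"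
    by (simp add: fps_binomial_deriv fps_divide_unit fps_binomial_minus_one mult.assoc)
  also have "fps_binomial a * fps_binomial (- 1) = fps_binomial (a - 1)"
    by (simp flip: fps_binomial_add_mult)
  finally show ?thesis .
qed

lemma fps_deriv_rpow:
  assumes "H $ 0 = 1"
  shows "fps_deriv (fps_rpow H a) = fps_const a * fps_rpow H (a - 1) * fps_deriv H"
  using assms
  by (simp add: fps_rpow_def fps_compose_deriv fps_deriv_binomial fps_compose_mult_distrib)

lemma fps_rpow_mult:
  assumes H: "H $ 0 = 1" and K: "K $ 0 = 1"
  shows "fps_rpow (H * K) a = fps_rpow H a * fps_rpow K a"
proof -
  let ?M = "H * K"
  have M: "?M $ 0 = 1" using H K by simp
  have inv: "L * fps_rpow L (- 1) = 1" if "L $ 0 = 1" for L :: "'a fps"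
    using fps_rpow_add[OF that, of 1 "- 1"] fps_rpow_1[OF that] by simp
  have pred: "fps_rpow L (b - 1) = fps_rpow L b * fps_rpow L (- 1)" if "L $ 0 = 1" for L :: "'a fps" and b
    using fps_rpow_add[OF that, of b "- 1"] by simp
  have Minv: "fps_rpow ?M (- 1) = fps_rpow H (- 1) * fps_rpow K (- 1)"
  proof -
    have "fps_rpow ?M (- 1) = fps_rpow ?M (- 1) * (H * fps_rpow H (- 1)) * (K * fps_rpow K (- 1))"
      by (simp add: inv H K)
    also have "\<dots> = (?M * fps_rpow ?M (- 1)) * (fps_rpow H (- 1) * fps_rpow K (- 1))"
      by (simp only: mult_ac)
    finally show ?thesis by (simp only: inv[OF M] mult_1_left)
  qed
  define D where "D = fps_rpow ?M a * fps_rpow H (- a) * fps_rpow K (- a)"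
  define h k where "h = fps_rpow H (- 1)" and "k = fps_rpow K (- 1)"
  \<comment> \<open>The logarithmic derivative of a product is the sum of the logarithmic derivatives,
    so that of this quotient vanishes.\<close>
  have "fps_deriv D = fps_const a * D * (h * k * fps_deriv ?M - h * fps_deriv H - k * fps_deriv K)"
    unfolding D_def fps_deriv_mult[of _ "fps_rpow K (- a)"] fps_deriv_mult[of _ "fps_rpow H (- a)"]
      fps_deriv_rpow[OF H] fps_deriv_rpow[OF K] fps_deriv_rpow[OF M]
      pred[OF H] pred[OF K] pred[OF M] Minv h_def[symmetric] k_def[symmetric]
    by (simp add: algebra_simps flip: fps_const_neg)
  also have "h * k * fps_deriv ?M = (K * k) * h * fps_deriv H + (H * h) * k * fps_deriv K"
    by (simp add: algebra_simps)
  also have "\<dots> = h * fps_deriv H + k * fps_deriv K"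
    by (simp add: h_def k_def inv H K)
  finally have "fps_deriv D = 0" by simp
  hence "D = fps_const (D $ 0)" by (simp add: fps_deriv_eq_0_iff)
  hence D1: "D = 1" by (simp add: D_def)
  have "fps_rpow ?M a = fps_rpow ?M a * (fps_rpow H (- a) * fps_rpow H a) * (fps_rpow K (- a) * fps_rpow K a)"
    by (simp flip: fps_rpow_add[OF H] fps_rpow_add[OF K])
  also have "\<dots> = D * (fps_rpow H a * fps_rpow K a)"
    by (simp only: D_def mult_ac)
  finally show ?thesis by (simp add: D1)
qed

lemma gbinomial_eq_poly: "\<exists>p. \<forall>a::'a::field_char_0. poly p a = a gchoose k"
  by (rule exI[of _ "smult (1 / fact k) (\<Prod>i<k. [:- of_nat i, 1:])"])
     (simp add: poly_prod gbinomial_prod_rev lessThan_atLeast0)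

lemma fps_rpow_nth_eq_poly:
  fixes H :: "'a::field_char_0 fps"
  shows "\<exists>p. \<forall>a. poly p a = fps_rpow H a $ n"
proof -
  obtain b where b: "\<And>k (a::'a). poly (b k) a = a gchoose k"
    using gbinomial_eq_poly by metis
  show ?thesis
    by (rule exI[of _ "\<Sum>k=0..n. smult ((H - 1) ^ k $ n) (b k)"])
       (simp add: fps_rpow_def fps_compose_nth poly_sum b mult.commute)
qed

section \<open>Euler coefficients\<close>

text \<open>The truncated geometric series \<open>F = 1 + t + \<dots> + t\<^bsup>r-1\<^esup>\<close>.\<close>

definition geometric_fps :: "nat \<Rightarrow> real fps" where
  "geometric_fps r = (\<Sum>i<r. fps_X ^ i)"

lemma euler_coeff_eq_rpow: "euler_coeff r x n = fps_rpow (geometric_fps r) x $ n"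
  by (simp add: euler_coeff_def fps_rpow_def geometric_fps_def)

lemma geometric_fps_nth_0: "r > 0 \<Longrightarrow> geometric_fps r $ 0 = 1"
  by (cases r) (simp_all add: geometric_fps_def lessThan_Suc_eq_insert_0 sum.reindex fps_sum_nth)

lemma geometric_fps_mult: "(1 - fps_X) * geometric_fps r = 1 - fps_X ^ r"
  by (simp add: geometric_fps_def one_diff_power_eq)

lemma fps_rpow_one_minus_X_power_nth:
  assumes "r > 0"
  shows "fps_rpow (1 - fps_X ^ r) a $ n
           = (if r dvd n then (- 1) ^ (n div r) * (a gchoose (n div r)) else 0)"
proof -
  have pw: "(- (fps_X ^ r)) ^ i $ n = (if n = r * i then (- 1 :: 'a) ^ i else 0)" for i
  proof -
    have "(- (fps_X ^ r :: 'a fps)) ^ i = fps_const ((- 1) ^ i) * fps_X ^ (r * i)"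
      by (subst power_minus) (simp add: power_mult flip: fps_const_power fps_const_neg)
    thus ?thesis by (simp only: fps_mult_left_const_nth fps_X_power_nth) simp
  qed
  have "fps_rpow (1 - fps_X ^ r) a $ n
          = (\<Sum>i=0..n. if n = r * i then (- 1) ^ i * (a gchoose i) else 0)"
    by (auto simp: fps_rpow_def fps_compose_nth pw intro!: sum.cong)
  also have "\<dots> = (\<Sum>i\<in>(if r dvd n then {n div r} else {}). (- 1) ^ i * (a gchoose i))"
    using assms by (intro sum.mono_neutral_cong_right) (auto split: if_splits)
  finally show ?thesis by simp
qed

lemma euler_coeff_eq_sum:
  assumes "r > 0"
  shows "euler_coeff r (x + 1) n
           = (\<Sum>i=0..n div r. (- 1) ^ i * ((x + 1) gchoose i)
                  * ((x + real n - real (r * i)) gchoose (n - r * i)))"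
proof -
  let ?F = "geometric_fps r" and ?y = "x + 1"
  have Y: "(1 - fps_X :: real fps) $ 0 = 1" by simp
  have inv: "fps_rpow (1 - fps_X) ?y * fps_rpow (1 - fps_X) (- ?y) = (1 :: real fps)"
    using fps_rpow_add[OF Y, of ?y "- ?y"] by simp
  have "fps_rpow (1 - fps_X ^ r) ?y = fps_rpow (1 - fps_X) ?y * fps_rpow ?F ?y"
    using fps_rpow_mult[OF Y geometric_fps_nth_0[OF assms]] by (simp only: geometric_fps_mult)
  hence "fps_rpow (1 - fps_X ^ r) ?y * fps_rpow (1 - fps_X) (- ?y)
      = (fps_rpow (1 - fps_X) ?y * fps_rpow (1 - fps_X) (- ?y)) * fps_rpow ?F ?y"
    by (simp only: mult_ac)
  hence F: "fps_rpow ?F ?y = fps_rpow (1 - fps_X ^ r) ?y * fps_rpow (1 - fps_X) (- ?y)"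
    by (simp only: inv mult_1_left)
  have neg: "fps_rpow (1 - fps_X) (- ?y) $ k = (x + real k) gchoose k" for k
  proof -
    have "fps_rpow (1 - fps_X) (- ?y) $ k = (- 1) ^ k * (- ?y gchoose k)"
      using fps_rpow_one_minus_X_power_nth[of 1 "- ?y" k] by (simp only: power_one_right) simp
    also have "\<dots> = ((- 1) ^ k * (- 1) ^ k) * (?y + real k - 1 gchoose k)"
      by (simp only: gbinomial_minus mult.assoc)
    also have "(- 1) ^ k * (- 1) ^ k = (1 :: real)"
      by (simp flip: power_mult_distrib)
    also have "?y + real k - 1 = x + real k" by simp
    finally show ?thesis by simp
  qed
  have "euler_coeff r ?y n = (\<Sum>j=0..n. fps_rpow (1 - fps_X ^ r) ?y $ j
            * ((x + real (n - j)) gchoose (n - j)))"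
    by (simp only: euler_coeff_eq_rpow F fps_mult_nth neg)
  \<comment> \<open>Only multiples of \<open>r\<close> contribute.\<close>
  also have "\<dots> = (\<Sum>j\<in>(\<lambda>i. r * i) ` {0..n div r}. fps_rpow (1 - fps_X ^ r) ?y $ j
            * ((x + real (n - j)) gchoose (n - j)))"
    using assms
    by (intro sum.mono_neutral_right)
       (auto simp: fps_rpow_one_minus_X_power_nth less_eq_div_iff_mult_less_eq mult.commute 
             elim!: dvdE)
  also have "\<dots> = (\<Sum>i=0..n div r. fps_rpow (1 - fps_X ^ r) ?y $ (r * i)
            * ((x + real (n - r * i)) gchoose (n - r * i)))"
    using assms by (subst sum.reindex) (auto simp: inj_on_def)
  also have "\<dots> = (\<Sum>i=0..n div r. (- 1) ^ i * ((x + 1) gchoose i)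
                  * ((x + real n - real (r * i)) gchoose (n - r * i)))"
  proof (intro sum.cong refl)
    fix i assume "i \<in> {0..n div r}"
    hence "r * i \<le> n" using assms by (simp add: less_eq_div_iff_mult_less_eq mult.commute)
    hence "x + real (n - r * i) = x + real n - real (r * i)" by simp
    thus "fps_rpow (1 - fps_X ^ r) ?y $ (r * i) * ((x + real (n - r * i)) gchoose (n - r * i))
        = (- 1) ^ i * (?y gchoose i) * ((x + real n - real (r * i)) gchoose (n - r * i))"
      using assms by (simp only: fps_rpow_one_minus_X_power_nth) simp
  qed
  finally show ?thesis .
qed

section \<open>The generating function of the polynomials\<close>

text \<open>
  The series \<open>G\<^sub>x = F\<^sup>x (F - t F')\<close>, the generating function of the \<open>s\<^sub>n(x)\<close>. Unlike the
  quotient in the theorem it is defined at \<open>x = -1\<close> too, as the recurrence at all integers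
  demands.
\<close>

definition count_gf :: "nat \<Rightarrow> real \<Rightarrow> real fps" where
  "count_gf r x = fps_rpow (geometric_fps r) x
     * (geometric_fps r - fps_X * fps_deriv (geometric_fps r))"

lemma count_gf_nth_eq_poly: "\<exists>p. \<forall>x. poly p x = count_gf r x $ n"
proof -
  obtain b where b: "\<And>k x. poly (b k) x = fps_rpow (geometric_fps r) x $ k"
    using fps_rpow_nth_eq_poly by metis
  show ?thesis
    by (rule exI[of _ "\<Sum>k=0..n. smult ((geometric_fps r
          - fps_X * fps_deriv (geometric_fps r)) $ (n - k)) (b k)"])
       (simp add: count_gf_def fps_mult_nth poly_sum b mult.commute)
qed

lemma count_gf_nth_eq_euler_coeff:
  assumes "r > 0"
  shows "(x + 1) * count_gf r x $ n = (x - real n + 1) * euler_coeff r (x + 1) n"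
proof -
  let ?F = "geometric_fps r"
  note F0 = geometric_fps_nth_0[OF assms]
  have "fps_deriv (fps_rpow ?F (x + 1)) = fps_const (x + 1) * fps_rpow ?F x * fps_deriv ?F"
    using fps_deriv_rpow[OF F0, of "x + 1"] by simp
  hence "fps_const (x + 1) * count_gf r x
      = fps_const (x + 1) * fps_rpow ?F (x + 1) - fps_X * fps_deriv (fps_rpow ?F (x + 1))"
    by (simp only: count_gf_def fps_rpow_add[OF F0] fps_rpow_1[OF F0]) (simp only: algebra_simps)
  hence "(fps_const (x + 1) * count_gf r x) $ n
      = (fps_const (x + 1) * fps_rpow ?F (x + 1) - fps_X * fps_deriv (fps_rpow ?F (x + 1))) $ n"
    by simp
  thus ?thesis
    by (cases n) (simp_all add: euler_coeff_eq_rpow algebra_simps)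
qed

lemma count_gf_nth_0: "r > 0 \<Longrightarrow> count_gf r x $ 0 = 1"
  by (simp add: count_gf_def geometric_fps_nth_0)

lemma count_gf_nth_boundary:
  assumes "r > 0" "n > 0"
  shows "count_gf r (real n - 1) $ n = 0"
  using count_gf_nth_eq_euler_coeff[OF assms(1), of "real n - 1" n] assms(2) by simp

lemma count_gf_recurrence:
  assumes "r > 0" "n > 0"
  shows "count_gf r x $ n = count_gf r x $ (n - 1) + count_gf r (x - 1) $ n
           - (if n < r then 0 else count_gf r (x - 1) $ (n - r))"
proof -
  let ?F = "geometric_fps r"
  note F0 = geometric_fps_nth_0[OF assms(1)]
  have "fps_rpow ?F x = fps_rpow ?F (x - 1) * ?F"
    using fps_rpow_add[OF F0, of "x - 1" 1] by (simp add: fps_rpow_1[OF F0])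
  hence "(1 - fps_X) * count_gf r x = ((1 - fps_X) * ?F) * count_gf r (x - 1)"
    by (simp add: count_gf_def mult_ac)
  hence "((1 - fps_X) * count_gf r x) $ n = ((1 - fps_X ^ r) * count_gf r (x - 1)) $ n"
    by (simp only: geometric_fps_mult)
  thus ?thesis using assms
    by (simp add: left_diff_distrib fps_X_power_mult_nth split: if_splits)
qed

section \<open>Counting the paths by their last step\<close>

lemma endpoint_snoc:
  "endpoint (w @ [s]) = (fst (endpoint w) + (if s = East then 1 else 0),
     snd (endpoint w) + (if s = North then 1 else 0))"
  by (cases s) (simp_all add: endpoint_def)

lemma weakly_above_diagonal_snoc:
  "weakly_above_diagonal (w @ [s]) \<longleftrightarrow> weakly_above_diagonal w
     \<and> fst (endpoint (w @ [s])) \<le> snd (endpoint (w @ [s]))"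
  by (auto simp: weakly_above_diagonal_def)

lemma weakly_above_diagonal_endpoint:
  "weakly_above_diagonal w \<Longrightarrow> fst (endpoint w) \<le> snd (endpoint w)"
  by (auto simp: weakly_above_diagonal_def)

lemma replicate_East_snoc: "r > 0 \<Longrightarrow> replicate r East = replicate (r - 1) East @ [East]"
  by (cases r) (simp_all add: replicate_append_same)

lemma sublist_replicate_snoc_North:
  "r > 0 \<Longrightarrow> sublist (replicate r East) (w @ [North]) \<longleftrightarrow> sublist (replicate r East) w"
  by (simp add: sublist_snoc replicate_East_snoc)

lemma sublist_replicate_snoc_East:
  "r > 0 \<Longrightarrow> sublist (replicate r East) (w @ [East])
     \<longleftrightarrow> sublist (replicate r East) w \<or> suffix (replicate (r - 1) East) w"
  by (auto simp add: sublist_snoc replicate_East_snoc)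

lemma finite_lattice_paths: "finite (lattice_paths r n m)"
proof (rule finite_subset)
  have len: "length w = count_list w East + count_list w North" for w :: "step list"
  proof (induction w)
    case (Cons s w)
    thus ?case by (cases s) auto
  qed simp
  have UN: "(UNIV :: step set) = {North, East}" using step.exhaust by blast
  show "lattice_paths r n m \<subseteq> {w. set w \<subseteq> UNIV \<and> length w = nat (n + m)}"
    by (auto simp: lattice_paths_def endpoint_def len)
  show "finite {w :: step list. set w \<subseteq> UNIV \<and> length w = nat (n + m)}"
    by (rule finite_lists_length_eq) (simp add: UN)
qed

lemma path_count_eq_0:
  assumes "n < 0 \<or> m < n"
  shows "path_count r n m = 0"
proof -
  have "lattice_paths r n m = {}"
    using assms weakly_above_diagonal_endpoint
    by (fastforce simp: lattice_paths_def endpoint_def)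
  thus ?thesis by (simp add: path_count_def)
qed

lemma path_count_0:
  assumes "r > 0" "m \<ge> 0"
  shows "path_count r 0 m = 1"
proof -
  have N: "count_list w East = 0 \<longrightarrow> w = replicate (count_list w North) North" for w
  proof (induction w)
    case (Cons s w)
    thus ?case by (cases s) auto
  qed simp
  have c: "count_list (replicate k North) East = 0" "count_list (replicate k North) North = k" for k
    by (induction k) auto
  have "lattice_paths r 0 m = {replicate (nat m) North}"
  proof (intro equalityI subsetI)
    fix w assume "w \<in> lattice_paths r 0 m"
    hence "count_list w East = 0" "count_list w North = nat m"
      by (auto simp: lattice_paths_def endpoint_def)
    thus "w \<in> {replicate (nat m) North}" using N[of w] by simp
  next
    fix w assume w: "w \<in> {replicate (nat m) North}"
    have "\<not> sublist (replicate r East) w"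
      using set_mono_sublist[of "replicate r East" w] assms(1) w by auto
    moreover have "weakly_above_diagonal w"
    proof -
      have "fst (endpoint u) \<le> snd (endpoint u)" if "prefix u w" for u
      proof -
        have "East \<notin> set u" using set_mono_prefix[OF that] w by auto
        thus ?thesis by (simp add: endpoint_def)
      qed
      thus ?thesis by (simp add: weakly_above_diagonal_def)
    qed
    ultimately show "w \<in> lattice_paths r 0 m"
      using w assms(2) by (simp add: lattice_paths_def endpoint_def c)
  qed
  thus ?thesis by (simp add: path_count_def)
qed

text \<open>
  A run of fewer than \<open>r\<close> East steps after a North step cannot create a forbidden run, and
  the whole run stays weakly above the diagonal as soon as its endpoint does.
\<close>

lemma append_East_run:
  assumes "k < r"
  shows "w @ [North] @ replicate k East \<in> lattice_paths r (n + int k) m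
     \<longleftrightarrow> w @ [North] \<in> lattice_paths r n m \<and> n + int k \<le> m"
  using assms
proof (induction k)
  case 0
  thus ?case using weakly_above_diagonal_endpoint[of "w @ [North]"]
    by (auto simp: lattice_paths_def)
next
  case (Suc k)
  have nosuf: "\<not> suffix (replicate (r - 1) East) (w @ [North] @ replicate k East)"
  proof
    assume "suffix (replicate (r - 1) East) (w @ [North] @ replicate k East)"
    moreover have "r - 1 = Suc (r - 2 - k) + k" using Suc.prems by simp
    ultimately have "suffix (replicate (Suc (r - 2 - k)) East @ replicate k East)
        ((w @ [North]) @ replicate k East)"
      by (simp only: replicate_add append_assoc)
    hence "suffix (replicate (Suc (r - 2 - k)) East) (w @ [North])"
      by (simp only: same_suffix_suffix)
    thus False
      by (simp only: replicate_Suc replicate_append_same[symmetric] snoc_suffix_snoc) simp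
  qed
  have "w @ [North] @ replicate (Suc k) East = (w @ [North] @ replicate k East) @ [East]"
    by (simp add: replicate_append_same)
  hence "w @ [North] @ replicate (Suc k) East \<in> lattice_paths r (n + int (Suc k)) m
     \<longleftrightarrow> w @ [North] @ replicate k East \<in> lattice_paths r (n + int k) m \<and> n + int (Suc k) \<le> m"
    using Suc.prems nosuf
    by (auto simp del: append_assoc simp: lattice_paths_def weakly_above_diagonal_snoc endpoint_snoc
        sublist_replicate_snoc_East prod_eq_iff)
  thus ?case using Suc by auto
qed

lemma path_count_recurrence:
  assumes "r > 0" "n > 0" "m \<ge> n"
  shows "path_count r n m
           = path_count r (n - 1) m + path_count r n (m - 1) - path_count r (n - int r) (m - 1)"
proof -
  let ?L = "lattice_paths r" and ?run = "replicate (r - 1) East"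
  \<comment> \<open>The paths to which no East step can be appended.\<close>
  define B where "B = {u \<in> ?L (n - 1) m. suffix ?run u}"
  have snocN: "w @ [North] \<in> ?L k m \<longleftrightarrow> w \<in> ?L k (m - 1)" if "k \<le> m" for w k
    using assms that
    by (auto simp: lattice_paths_def weakly_above_diagonal_snoc endpoint_snoc
        sublist_replicate_snoc_North prod_eq_iff)
  have snocE: "w @ [East] \<in> ?L n m \<longleftrightarrow> w \<in> ?L (n - 1) m - B" for w
    using assms
    by (auto simp: B_def lattice_paths_def weakly_above_diagonal_snoc endpoint_snoc
        sublist_replicate_snoc_East prod_eq_iff)
  have split: "?L n m = (\<lambda>w. w @ [North]) ` ?L n (m - 1) \<union> (\<lambda>w. w @ [East]) ` (?L (n - 1) m - B)"
  proof (intro equalityI subsetI)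
    fix w assume w: "w \<in> ?L n m"
    have "w \<noteq> []" using w assms by (auto simp: lattice_paths_def endpoint_def)
    then obtain u s where "w = u @ [s]" by (cases w rule: rev_cases) auto
    thus "w \<in> (\<lambda>w. w @ [North]) ` ?L n (m - 1) \<union> (\<lambda>w. w @ [East]) ` (?L (n - 1) m - B)"
      using w snocN[of n u] snocE[of u] assms by (cases s) auto
  qed (use snocN snocE assms in auto)
  have B: "B = (\<lambda>w. w @ [North] @ ?run) ` ?L (n - int r) (m - 1)"
  proof -
    have iff: "w @ [North] @ ?run \<in> ?L (n - 1) m \<longleftrightarrow> w \<in> ?L (n - int r) (m - 1)" for w
      using append_East_run[of "r - 1" r w "n - int r" m] snocN[of "n - int r" w] assms
      by (simp add: algebra_simps)
    have "\<exists>v. u = v @ [North] @ ?run" if u: "u \<in> B" for u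
    proof -
      obtain v where v: "u = v @ ?run" using u by (auto simp: B_def suffix_def)
      \<comment> \<open>The height is at least one, so something precedes the run; it is not an East step,
        which would make the run too long.\<close>
      have "v \<noteq> []"
      proof
        assume "v = []"
        hence "snd (endpoint u) = 0" by (simp add: v endpoint_def)
        thus False using u assms by (simp add: B_def lattice_paths_def)
      qed
      then obtain v' s where s: "v = v' @ [s]" by (cases v rule: rev_cases) auto
      have "s \<noteq> East"
      proof
        assume "s = East"
        hence "u = v' @ replicate r East" using assms(1) by (cases r) (simp_all add: v s)
        thus False using u by (auto simp: B_def lattice_paths_def)
      qed
      thus ?thesis using v s by (cases s) auto
    qed
    thus ?thesis using iff unfolding B_def by (fastforce simp: suffix_def)
  qed
  have cB: "card B = card (?L (n - int r) (m - 1))"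
    unfolding B by (intro card_image) (auto simp: inj_on_def)
  have "card (?L n m) = card (?L n (m - 1)) + card (?L (n - 1) m - B)"
    unfolding split
    by (subst card_Un_disjoint) (auto simp: finite_lattice_paths card_image inj_on_def)
  also have "card (?L (n - 1) m - B) = card (?L (n - 1) m) - card B"
    by (rule card_Diff_subset) (auto simp: B_def finite_lattice_paths)
  finally have "card (?L n m) = card (?L n (m - 1)) + (card (?L (n - 1) m) - card B)" .
  moreover have "card B \<le> card (?L (n - 1) m)"
    by (rule card_mono) (auto simp: B_def finite_lattice_paths)
  ultimately show ?thesis by (simp add: path_count_def cB)
qed

section \<open>The extended counts\<close>

lemma extended_count_neg: "n < 0 \<Longrightarrow> extended_count r n m = 0"
  by (subst extended_count.simps) simp

lemma extended_count_0: "r > 0 \<Longrightarrow> extended_count r 0 m = 1"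
  by (subst extended_count.simps) simp

lemma extended_count_boundary: "n > 0 \<Longrightarrow> extended_count r n (n - 1) = 0"
  by (subst extended_count.simps) simp

text \<open>
  The case \<open>m = n - 1\<close> is included: for \<open>n > 0\<close> both sides are 0 there. At \<open>n = 0\<close>, \<open>m < 0\<close>
  the extended count is 1 although there is no path.
\<close>

lemma extended_count_eq_path_count:
  assumes "r > 0" "m \<ge> 0" "m \<ge> n - 1"
  shows "extended_count r n m = path_count r n m"
proof (cases "n \<le> 0 \<or> m < n")
  case True
  thus ?thesis using assms
    by (subst extended_count.simps) (auto simp: path_count_0 path_count_eq_0)
next
  case False
  thus ?thesis using assms by (subst extended_count.simps) auto
qed

text \<open>
  On and above the diagonal this is the recurrence for paths; below it, it is the definition of
  the extension.
\<close>

lemma extended_count_recurrence: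
  assumes "r > 0" "n > 0"
  shows "extended_count r n m = extended_count r (n - 1) m + extended_count r n (m - 1)
           - extended_count r (n - int r) (m - 1)"
proof (cases "m \<ge> n")
  case True
  thus ?thesis using assms path_count_recurrence[of r n m]
    by (simp add: extended_count_eq_path_count)
next
  case False
  thus ?thesis using assms extended_count.simps[of r n "m - 1"] by simp
qed

lemma extended_count_eq_count_gf:
  assumes "r > 0"
  shows "of_int (extended_count r (int n) m) = count_gf r (of_int m) $ n"
proof (induction n arbitrary: m rule: less_induct)
  case (less n)
  show ?case
  proof (cases "n = 0")
    case True
    thus ?thesis using assms by (simp add: extended_count_0 count_gf_nth_0)
  next
    case False
    define d where "d k = of_int (extended_count r (int n) k) - count_gf r (of_int k) $ n" for k
    \<comment> \<open>The two recurrences have the same lower-order terms, so the difference \<open>d\<close> is constant;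
      it vanishes at \<open>n - 1\<close>.\<close>
    have "of_int (extended_count r (int n - int r) k)
        = (if n < r then 0 else count_gf r (of_int k) $ (n - r))" for k
      using less.IH[of "n - r" k] assms False
      by (auto simp: extended_count_neg)
    moreover have "of_int (extended_count r (int n - 1) k) = count_gf r (of_int k) $ (n - 1)" for k
      using less.IH[of "n - 1" k] False by simp
    ultimately have step: "d k = d (k - 1)" for k
      using extended_count_recurrence[OF assms, of "int n" k]
        count_gf_recurrence[OF assms, of n "of_int k"] False
      by (simp add: d_def)
    have "d m = 0"
    proof (induction m rule: int_induct[where k = "int n - 1"])
      case base
      show ?case using extended_count_boundary[of "int n" r] count_gf_nth_boundary[OF assms, of n] False
        by (simp add: d_def)
    next
      case (step1 i)
      thus ?case using step[of "i + 1"] by simp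
    next
      case (step2 i)
      thus ?case using step[of i] by simp
    qed
    thus ?thesis by (simp add: d_def)
  qed
qed

lemma poly_count_poly:
  assumes "r > 0"
  shows "poly (count_poly r n) x = count_gf r x $ n"
proof -
  obtain p where p: "\<And>x. poly p x = count_gf r x $ n"
    using count_gf_nth_eq_poly by metis
  have "count_poly r n = p"
    unfolding count_poly_def
  proof (rule the_equality)
    show "\<forall>m::int. poly p (of_int m) = of_int (extended_count r (int n) m)"
      by (simp add: p extended_count_eq_count_gf[OF assms])
  next
    fix q :: "real poly"
    assume q: "\<forall>m::int. poly q (of_int m) = of_int (extended_count r (int n) m)"
    show "q = p"
    proof (rule ccontr)
      assume "q \<noteq> p"
      hence "finite {y. poly (q - p) y = 0}" by (intro poly_roots_finite) simp
      moreover have "range (of_int :: int \<Rightarrow> real) \<subseteq> {y. poly (q - p) y = 0}"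
        using q by (auto simp: p extended_count_eq_count_gf[OF assms])
      ultimately have "finite (range (of_int :: int \<Rightarrow> real))" by (rule finite_subset[rotated])
      thus False by (simp add: finite_image_iff inj_on_def)
    qed
  qed
  thus ?thesis by (simp add: p)
qed

theorem theorem5:
  fixes r n :: nat and x :: real
  assumes "r > 0" and "x \<noteq> - 1"
  shows "poly (count_poly r n) x
           = (x - real n + 1) / (x + 1) * euler_coeff r (x + 1) n
       \<and> (x - real n + 1) / (x + 1) * euler_coeff r (x + 1) n
           = (x - real n + 1) / (x + 1) *
               (\<Sum>i=0..n div r. (- 1) ^ i * ((x + 1) gchoose i)
                  * ((x + real n - real (r * i)) gchoose (n - r * i)))"
proof
  have "x + 1 \<noteq> 0" using assms(2) by linarith
  thus "poly (count_poly r n) x = (x - real n + 1) / (x + 1) * euler_coeff r (x + 1) n"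
    using count_gf_nth_eq_euler_coeff[OF assms(1), of x n]
    by (simp add: poly_count_poly[OF assms(1)] eq_divide_eq mult.commute)
qed (simp only: euler_coeff_eq_sum[OF assms(1)])

end
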